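(* Consider the dynamics $\dot x=f(t,x)$ with $f:\mathbb{R}_{\ge0}\times\mathbb{R}^n\to\mathbb{R}^n$ continuous in $(t,x)$. Assume there exists $x^*$ satisfying $f(t,x^* )=0_n$ for all $t\ge0$. Let $C\subseteq\mathbb{R}^n$ be open, connected, and forward invariant with $x^*\in C$, and let $\|\cdot\|$ be a norm on $\mathbb{R}^n$ with compatible weak pairing $[\![\cdot,\cdot]\!]$ satisfying Deimling's inequality and the curve norm derivative formula. Then, for $b\in\mathbb{R}$, the following statements are equivalent: (i) $[\![f(t,x),x-x^*]\!]\le b\|x-x^*\|^2$ for all $x\in C$, $t\ge0$; (ii) $D^+\|\phi(t,t_0,x_0)-x^*\|\le b\|\phi(t,t_0,x_0)-x^*\|$ for all $x_0\in C$, $0\le t_0\le t$; (iii) $\|\phi(t,t_0,x_0)-x^*\|\le e^{b(t-s)}\|\phi(s,t_0,x_0)-x^*\|$ for all $x_0\in C$, $0\le t_0\le s\le t$. Moreover, if $C$ is convex and there exists a continuous map $(t,x)\mapsto A(t,x)\in\mathbb{R}^{n\times n}$ such that $f(t,x)=A(t,x)(x-x^* )$ for all $t\ge0$, $x\in C$, then $\mu(A(t,x))\le b$ for all $t\ge0$, $x\in C$ implies (i), (ii), and (iii).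
   Context: A weak pairing on $\mathbb{R}^n$ is a map $[\![\cdot,\cdot]\!]:\mathbb{R}^n\times\mathbb{R}^n\to\mathbb{R}$ such that: (1) $[\![x_1+x_2,y]\!]\le[\![x_1,y]\!]+[\![x_2,y]\!]$ for all $x_1,x_2,y$, and it is continuous in its first argument; (2) $[\![\alpha x,y]\!]=[\![x,\alpha y]\!]=\alpha[\![x,y]\!]$ for all $x,y$ and all $\alpha\ge 0$, and $[\![-x,-y]\!]=[\![x,y]\!]$; (3) $[\![x,x]\!]>0$ for all $x\ne 0_n$; (4) $|[\![x,y]\!]|\le[\![x,x]\!]^{1/2}[\![y,y]\!]^{1/2}$ for all $x,y$. It is compatible with the norm $\|\cdot\|$ if $[\![x,x]\!]=\|x\|^2$ for all $x$. It satisfies Deimling's inequality if $[\![x,y]\!]\le\|y\|\lim_{h\to0^+}\frac{\|y+hx\|-\|y\|}{h}$ for all $x,y\in\mathbb{R}^n$. It satisfies the curve norm derivative formula if, for every differentiable $x:\,]a,b[\,\to\mathbb{R}^n$ and almost every $t\in\,]a,b[$, $\|x(t)\|D^+\|x(t)\|=[\![\dot x(t),x(t)]\!]$. Here $D^+\varphi(t)=\limsup_{h\to0^+}\frac{\varphi(t+h)-\varphi(t)}{h}$ is the upper right Dini derivative. $\phi(\cdot,t_0,x_0)$ denotes a (any) solution of $\dot x=f(t,x)$ with $x(t_0)=x_0$. Forward invariance of $C$: solutions starting in $C$ remain in $C$. $\mu(A)=\lim_{h\to0^+}\frac{\|I_n+hA\|-1}{h}$ (induced matrix norm) is the logarithmic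 norm. *)

theory Defs
  imports "HOL-Analysis.Analysis"
begin

text \<open>An arbitrary norm on the space, unrelated to the Euclidean norm of the type class.\<close>

definition is_norm :: "('a::real_vector \<Rightarrow> real) \<Rightarrow> bool" where
  "is_norm N \<longleftrightarrow>
     (\<forall>x. 0 \<le> N x) \<and>
     (\<forall>x. N x = 0 \<longleftrightarrow> x = 0) \<and>
     (\<forall>a x. N (a *\<^sub>R x) = \<bar>a\<bar> * N x) \<and>
     (\<forall>x y. N (x + y) \<le> N x + N y)"

definition weak_pairing :: "('a::real_normed_vector \<Rightarrow> 'a \<Rightarrow> real) \<Rightarrow> bool" where
  "weak_pairing W \<longleftrightarrow>
     (\<forall>x1 x2 y. W (x1 + x2) y \<le> W x1 y + W x2 y) \<and>
     (\<forall>y. continuous_on UNIV (\<lambda>x. W x y)) \<and>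
     (\<forall>\<alpha> x y. 0 \<le> \<alpha> \<longrightarrow> W (\<alpha> *\<^sub>R x) y = \<alpha> * W x y \<and> W x (\<alpha> *\<^sub>R y) = \<alpha> * W x y) \<and>
     (\<forall>x y. W (- x) (- y) = W x y) \<and>
     (\<forall>x. x \<noteq> 0 \<longrightarrow> 0 < W x x) \<and>
     (\<forall>x y. \<bar>W x y\<bar> \<le> sqrt (W x x) * sqrt (W y y))"

definition compatible :: "('a \<Rightarrow> real) \<Rightarrow> ('a \<Rightarrow> 'a \<Rightarrow> real) \<Rightarrow> bool" where
  "compatible N W \<longleftrightarrow> (\<forall>x. W x x = (N x)\<^sup>2)"

text \<open>For a norm the limit below exists: by convexity the difference quotient is
  nondecreasing in \<open>h > 0\<close>, and it is bounded below by \<open>- N x\<close>.\<close>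

definition deimling_inequality ::
  "('a::real_vector \<Rightarrow> real) \<Rightarrow> ('a \<Rightarrow> 'a \<Rightarrow> real) \<Rightarrow> bool" where
  "deimling_inequality N W \<longleftrightarrow>
     (\<forall>x y. W x y \<le> N y * Lim (at_right 0) (\<lambda>h. (N (y + h *\<^sub>R x) - N y) / h))"

text \<open>The upper right Dini derivative takes values in the extended reals.\<close>

definition upper_right_dini :: "(real \<Rightarrow> real) \<Rightarrow> real \<Rightarrow> ereal" where
  "upper_right_dini \<phi> t = Limsup (at_right 0) (\<lambda>h. ereal ((\<phi> (t + h) - \<phi> t) / h))"

definition curve_norm_derivative_formula ::
  "('a::real_normed_vector \<Rightarrow> real) \<Rightarrow> ('a \<Rightarrow> 'a \<Rightarrow> real) \<Rightarrow> bool" where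
  "curve_norm_derivative_formula N W \<longleftrightarrow>
     (\<forall>a b x x'. (\<forall>t\<in>{a<..<b}. (x has_vector_derivative x' t) (at t)) \<longrightarrow>
        (AE t in lebesgue. t \<in> {a<..<b} \<longrightarrow>
           ereal (N (x t)) * upper_right_dini (\<lambda>s. N (x s)) t = ereal (W (x' t) (x t))))"

text \<open>Solutions need be neither unique nor global, so a solution carries its interval of
  existence \<open>[t0, T)\<close> with \<open>T \<le> \<infinity>\<close>; its values outside that interval are irrelevant.
  The derivative at \<open>t0\<close> is one-sided.\<close>

definition is_solution ::
  "(real \<Rightarrow> 'a::real_normed_vector \<Rightarrow> 'a) \<Rightarrow> real \<Rightarrow> 'a \<Rightarrow> ereal \<Rightarrow> (real \<Rightarrow> 'a) \<Rightarrow> bool" where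
  "is_solution f t0 x0 T \<phi> \<longleftrightarrow>
     ereal t0 < T \<and> \<phi> t0 = x0 \<and>
     (\<forall>t. t0 \<le> t \<and> ereal t < T \<longrightarrow>
        (\<phi> has_vector_derivative f t (\<phi> t)) (at t within {s. t0 \<le> s \<and> ereal s < T}))"

definition forward_invariant ::
  "(real \<Rightarrow> 'a::real_normed_vector \<Rightarrow> 'a) \<Rightarrow> 'a set \<Rightarrow> bool" where
  "forward_invariant f C \<longleftrightarrow>
     (\<forall>t0 x0 T \<phi>. 0 \<le> t0 \<and> x0 \<in> C \<and> is_solution f t0 x0 T \<phi> \<longrightarrow>
        (\<forall>t. t0 \<le> t \<and> ereal t < T \<longrightarrow> \<phi> t \<in> C))"

definition induced_norm :: "(real^'n \<Rightarrow> real) \<Rightarrow> real^'n^'n \<Rightarrow> real" where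
  "induced_norm N A = (SUP x\<in>{x. N x = 1}. N (A *v x))"

definition log_norm :: "(real^'n \<Rightarrow> real) \<Rightarrow> real^'n^'n \<Rightarrow> real" where
  "log_norm N A = Lim (at_right 0) (\<lambda>h. (induced_norm N (mat 1 + h *\<^sub>R A) - 1) / h)"

definition one_sided_bound ::
  "(real \<Rightarrow> 'a::real_vector \<Rightarrow> 'a) \<Rightarrow> ('a \<Rightarrow> 'a \<Rightarrow> real) \<Rightarrow> ('a \<Rightarrow> real) \<Rightarrow> 'a set \<Rightarrow> 'a \<Rightarrow> real \<Rightarrow> bool"
  where
  "one_sided_bound f W N C xs b \<longleftrightarrow>
     (\<forall>x\<in>C. \<forall>t\<ge>0. W (f t x) (x - xs) \<le> b * (N (x - xs))\<^sup>2)"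

definition dini_decay ::
  "(real \<Rightarrow> 'a::real_normed_vector \<Rightarrow> 'a) \<Rightarrow> ('a \<Rightarrow> real) \<Rightarrow> 'a set \<Rightarrow> 'a \<Rightarrow> real \<Rightarrow> bool" where
  "dini_decay f N C xs b \<longleftrightarrow>
     (\<forall>t0 x0 T \<phi>. 0 \<le> t0 \<and> x0 \<in> C \<and> is_solution f t0 x0 T \<phi> \<longrightarrow>
        (\<forall>t. t0 \<le> t \<and> ereal t < T \<longrightarrow>
           upper_right_dini (\<lambda>s. N (\<phi> s - xs)) t \<le> ereal (b * N (\<phi> t - xs))))"

definition exponential_decay ::
  "(real \<Rightarrow> 'a::real_normed_vector \<Rightarrow> 'a) \<Rightarrow> ('a \<Rightarrow> real) \<Rightarrow> 'a set \<Rightarrow> 'a \<Rightarrow> real \<Rightarrow> bool" where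
  "exponential_decay f N C xs b \<longleftrightarrow>
     (\<forall>t0 x0 T \<phi>. 0 \<le> t0 \<and> x0 \<in> C \<and> is_solution f t0 x0 T \<phi> \<longrightarrow>
        (\<forall>s t. t0 \<le> s \<and> s \<le> t \<and> ereal t < T \<longrightarrow>
           N (\<phi> t - xs) \<le> exp (b * (t - s)) * N (\<phi> s - xs)))"

end

theory Submission
  imports Defs "HOL-Complex_Analysis.Great_Picard"
begin

text \<open>
  Write \<open>v t = N (\<phi> t - xs)\<close> for the distance of a solution to the equilibrium. The three
  conditions are linked in a cycle.

  The pointwise bound implies exponential decay (\<open>one_sided_bound_imp_exponential_decay\<close>): the curve
  norm derivative formula turns the bound on the pairing into \<open>D\<^sup>+ v \<le> b v\<close>, but only for almost
  every time. Since the solution is \<open>C\<^sup>1\<close>, the function \<open>exp (- b t) * v t\<close> is Lipschitz on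
  compact intervals, and a Lipschitz function whose upper right Dini derivative is nonpositive
  almost everywhere is nonincreasing (\<open>nonincreasing_if_AE_dini_nonpos\<close>). The exceptional null set is
  absorbed by subtracting a multiple of the measure of a small open set around it.

  Exponential decay implies the Dini estimate at every time
  (\<open>exponential_decay_imp_dini_decay\<close>) by dividing by the time step.

  The Dini estimate implies the pointwise bound (\<open>dini_decay_imp_one_sided_bound\<close>): through every
  point \<open>x\<close> of \<open>C\<close> and every initial time there passes a solution. As \<open>f\<close> is merely continuous this
  is Peano's theorem (\<open>peano_local\<close>). At the initial time the solution is tangent to the line with
  direction \<open>f t x\<close>, so the one-sided derivative of the norm along that line is at most
  \<open>b * N (x - xs)\<close>, and Deimling's inequality bounds the pairing by this derivative.

  If \<open>f t x = A t x *v (x - xs)\<close>, then the one-sided derivative of the norm in Deimling's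
  inequality is at most \<open>log_norm N (A t x) * N (x - xs)\<close>, because
  \<open>N (y + h *\<^sub>R (A *v y)) \<le> induced_norm N (mat 1 + h *\<^sub>R A) * N y\<close>
  (\<open>log_norm_imp_one_sided_bound\<close>).
\<close>

section \<open>Norms and their one-sided directional derivatives\<close>

text \<open>Deimling's inequality and the logarithmic norm both involve a one-sided derivative along a
  line: of the vector norm, and of the induced matrix norm at the identity. Seminorms on an
  arbitrary real vector space cover both.\<close>

definition seminorm :: "('v::real_vector \<Rightarrow> real) \<Rightarrow> bool" where
  "seminorm p \<longleftrightarrow> (\<forall>a x. p (a *\<^sub>R x) = \<bar>a\<bar> * p x) \<and> (\<forall>x y. p (x + y) \<le> p x + p y)"

lemma seminorm_scaleR: "seminorm p \<Longrightarrow> p (a *\<^sub>R x) = \<bar>a\<bar> * p x"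
  by (simp add: seminorm_def)

lemma seminorm_triangle: "seminorm p \<Longrightarrow> p (x + y) \<le> p x + p y"
  by (simp add: seminorm_def)

lemma seminorm_minus: "seminorm p \<Longrightarrow> p (- x) = p x"
  using seminorm_scaleR[of p "-1" x] by simp

lemma seminorm_zero: "seminorm p \<Longrightarrow> p 0 = 0"
  using seminorm_scaleR[of p 0] by simp

lemma seminorm_diff: "seminorm p \<Longrightarrow> p x - p y \<le> p (x - y)"
  using seminorm_triangle[of p "x - y" y] by simp

lemma is_norm_imp_seminorm: "is_norm N \<Longrightarrow> seminorm N"
  by (simp add: is_norm_def seminorm_def)

text \<open>Convexity along a line: \<open>y + h *\<^sub>R x\<close> is the convex combination of \<open>y\<close> and \<open>y + k *\<^sub>R x\<close> with
  weights \<open>1 - h/k\<close> and \<open>h/k\<close>.\<close>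

lemma seminorm_quotient_mono:
  assumes p: "seminorm p" and "0 < h" "h \<le> k"
  shows "(p (y + h *\<^sub>R x) - p y) / h \<le> (p (y + k *\<^sub>R x) - p y) / k"
proof -
  have k: "0 < k" using assms by simp
  have eq: "y + h *\<^sub>R x = (1 - h/k) *\<^sub>R y + (h/k) *\<^sub>R (y + k *\<^sub>R x)"
    using k by (simp add: algebra_simps)
  have "p (y + h *\<^sub>R x) \<le> \<bar>1 - h/k\<bar> * p y + \<bar>h/k\<bar> * p (y + k *\<^sub>R x)"
    unfolding eq using p by (metis seminorm_triangle seminorm_scaleR)
  also have "\<dots> = (1 - h/k) * p y + (h/k) * p (y + k *\<^sub>R x)"
    using assms k by simp
  finally show ?thesis using assms k by (simp add: field_simps)
qed

text \<open>As the difference quotient is monotone and bounded below by \<open>- p x\<close>, it converges to its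
  infimum.\<close>

lemma seminorm_quotient_tendsto:
  assumes p: "seminorm p"
  shows "\<exists>L. ((\<lambda>h. (p (y + h *\<^sub>R x) - p y) / h) \<longlongrightarrow> L) (at_right 0)"
proof -
  define q where "q h = (p (y + h *\<^sub>R x) - p y) / h" for h
  have lb: "- p x \<le> q h" if "0 < h" for h
  proof -
    have "p (y + h *\<^sub>R x) + p (- (h *\<^sub>R x)) \<ge> p y"
      using seminorm_triangle[OF p, of "y + h *\<^sub>R x" "- (h *\<^sub>R x)"] by simp
    then have "p y - h * p x \<le> p (y + h *\<^sub>R x)"
      using that by (simp add: seminorm_minus[OF p] seminorm_scaleR[OF p])
    then show ?thesis using that by (simp add: q_def field_simps)
  qed
  have bdd: "bdd_below (q ` {0<..})" using lb by (auto intro!: bdd_belowI2)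
  have "(q \<longlongrightarrow> Inf (q ` {0<..})) (at_right 0)"
  proof (rule order_tendstoI)
    fix a assume "a < Inf (q ` {0<..})"
    then have "a < q h" if "0 < h" for h
      using cInf_lower[OF _ bdd, of "q h"] that by force
    then show "\<forall>\<^sub>F h in at_right 0. a < q h"
      by (auto simp: eventually_at_right_field intro!: exI[of _ 1])
  next
    fix a assume "Inf (q ` {0<..}) < a"
    then obtain k where k: "0 < k" "q k < a"
      by (subst (asm) cInf_less_iff) (use bdd in auto)
    have "q h < a" if "0 < h" "h < k" for h
      using seminorm_quotient_mono[OF p, of h k y x] that k by (simp add: q_def)
    then show "\<forall>\<^sub>F h in at_right 0. q h < a"
      using k by (auto simp: eventually_at_right_field)
  qed
  then show ?thesis unfolding q_def by blast
qed

text \<open>\<open>Lim\<close> is a definite description, so it carries information only once convergence is known.\<close>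

lemma seminorm_quotient_Lim:
  assumes p: "seminorm p"
  shows "((\<lambda>h. (p (y + h *\<^sub>R x) - p y) / h) \<longlongrightarrow>
           Lim (at_right 0) (\<lambda>h. (p (y + h *\<^sub>R x) - p y) / h)) (at_right 0)"
proof -
  obtain L where L: "((\<lambda>h. (p (y + h *\<^sub>R x) - p y) / h) \<longlongrightarrow> L) (at_right 0)"
    using seminorm_quotient_tendsto[OF p] by blast
  have "Lim (at_right 0) (\<lambda>h. (p (y + h *\<^sub>R x) - p y) / h) = L"
    by (rule tendsto_Lim[OF _ L]) simp
  with L show ?thesis by simp
qed

text \<open>All norms on a finite-dimensional space are equivalent. Here is the upper bound, obtained by
  expanding in the standard basis; the lower bound \<open>norm_le_is_norm\<close> then follows by compactness of
  the Euclidean sphere.\<close>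

lemma is_norm_le_norm:
  fixes N :: "'a::euclidean_space \<Rightarrow> real"
  assumes "is_norm N"
  obtains K where "0 < K" "\<And>x. N x \<le> K * norm x"
proof
  let ?K = "(\<Sum>i\<in>Basis. N i) + 1"
  have nn: "0 \<le> N x" for x using assms by (simp add: is_norm_def)
  have sn: "seminorm N" by (rule is_norm_imp_seminorm[OF assms])
  have fin: "N (sum g A) \<le> (\<Sum>i\<in>A. N (g i))" if "finite A" for g and A :: "'a set"
    using that
  proof (induction A)
    case (insert i A)
    then show ?case using seminorm_triangle[OF sn, of "g i" "sum g A"] by simp
  qed (simp add: seminorm_zero[OF sn])
  show "0 < ?K" by (simp add: sum_nonneg nn add_nonneg_pos)
  fix x
  have "N x = N (\<Sum>i\<in>Basis. (x \<bullet> i) *\<^sub>R i)" by (simp add: euclidean_representation)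
  also have "\<dots> \<le> (\<Sum>i\<in>Basis. \<bar>x \<bullet> i\<bar> * N i)"
    using fin[of Basis "\<lambda>i. (x \<bullet> i) *\<^sub>R i"] by (simp add: seminorm_scaleR[OF sn])
  also have "\<dots> \<le> (\<Sum>i\<in>Basis. norm x * N i)"
    by (intro sum_mono mult_right_mono Basis_le_norm nn)
  also have "\<dots> = norm x * (\<Sum>i\<in>Basis. N i)" by (simp add: sum_distrib_left)
  also have "\<dots> \<le> ?K * norm x" by (simp add: algebra_simps)
  finally show "N x \<le> ?K * norm x" .
qed

lemma is_norm_lipschitz:
  fixes N :: "'a::euclidean_space \<Rightarrow> real"
  assumes "is_norm N"
  obtains K where "0 < K" "\<And>x. N x \<le> K * norm x" "K-lipschitz_on UNIV N"
proof -
  obtain K where K: "0 < K" "\<And>x. N x \<le> K * norm x"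
    using is_norm_le_norm[OF assms] by blast
  note sn = is_norm_imp_seminorm[OF assms]
  have "\<bar>N x - N y\<bar> \<le> K * norm (x - y)" for x y
    using seminorm_diff[OF sn, of x y] seminorm_diff[OF sn, of y x] K(2)[of "x - y"] K(2)[of "y - x"]
    by (simp add: norm_minus_commute abs_le_iff)
  then have "K-lipschitz_on UNIV N"
    using K(1) by (intro lipschitz_onI) (auto simp: dist_norm)
  with K that show ?thesis by blast
qed

lemma norm_le_is_norm:
  fixes N :: "'a::euclidean_space \<Rightarrow> real"
  assumes N: "is_norm N"
  obtains c where "0 < c" "\<And>x. c * norm x \<le> N x"
proof -
  obtain K where "K-lipschitz_on UNIV N" using is_norm_lipschitz[OF N] by blast
  then have "continuous_on (sphere 0 1) N"
    by (meson lipschitz_on_continuous_on continuous_on_subset subset_UNIV)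
  then obtain z where z: "z \<in> sphere 0 1" "\<And>x. x \<in> sphere 0 1 \<Longrightarrow> N z \<le> N x"
    using continuous_attains_inf[of "sphere 0 1" N] by auto
  show ?thesis
  proof
    show "0 < N z" using N z(1) by (auto simp: is_norm_def less_le)
    show "N z * norm x \<le> N x" for x
    proof (cases "x = 0")
      case False
      then have "N z \<le> N ((1 / norm x) *\<^sub>R x)" by (intro z(2)) simp
      also have "\<dots> = N x / norm x"
        by (simp add: seminorm_scaleR[OF is_norm_imp_seminorm[OF N]])
      finally show ?thesis using False by (simp add: field_simps)
    qed (use N in \<open>simp add: is_norm_def\<close>)
  qed
qed

section \<open>Dini derivatives and monotonicity\<close>

text \<open>Bounds on the extended-real Dini derivative are used in the form of linear bounds with an
  arbitrarily small slack, which needs no arithmetic in the extended reals.\<close>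

lemma upper_right_dini_leD:
  assumes "upper_right_dini \<phi> t \<le> ereal c" "0 < e"
  shows "\<forall>\<^sub>F h in at_right 0. \<phi> (t + h) \<le> \<phi> t + (c + e) * h"
proof -
  have "Limsup (at_right 0) (\<lambda>h. ereal ((\<phi> (t + h) - \<phi> t) / h)) < ereal (c + e)"
    using assms unfolding upper_right_dini_def
    by (metis ereal_less_eq(3) less_add_same_cancel1 less_ereal.simps(1) order_le_less_trans)
  then have "\<forall>\<^sub>F h in at_right 0. ereal ((\<phi> (t + h) - \<phi> t) / h) < ereal (c + e)"
    by (rule Limsup_lessD)
  moreover have "\<forall>\<^sub>F h in at_right 0. (0::real) < h"
    by (rule eventually_at_right_less)
  ultimately show ?thesis
    by eventually_elim (auto simp: field_simps)
qed

lemma upper_right_dini_leI: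
  assumes ev: "\<forall>\<^sub>F h in at_right 0. \<phi> (t + h) \<le> \<phi> t + r h * h"
    and lim: "(r \<longlongrightarrow> c) (at_right 0)"
  shows "upper_right_dini \<phi> t \<le> ereal c"
proof -
  have "\<forall>\<^sub>F h in at_right 0. (0::real) < h"
    by (rule eventually_at_right_less)
  with ev have "\<forall>\<^sub>F h in at_right 0. ereal ((\<phi> (t + h) - \<phi> t) / h) \<le> ereal (r h)"
    by eventually_elim (auto simp: field_simps)
  then have "upper_right_dini \<phi> t \<le> Limsup (at_right 0) (\<lambda>h. ereal (r h))"
    unfolding upper_right_dini_def by (rule Limsup_mono)
  also have "\<dots> = ereal c"
    using lim by (intro lim_imp_Limsup) auto
  finally show ?thesis .
qed

lemma DERIV_imp_eventually_le:
  fixes k :: "real \<Rightarrow> real"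
  assumes "(k has_real_derivative D) (at 0)" "D < e"
  shows "\<forall>\<^sub>F h in at_right 0. k h \<le> k 0 + e * h"
proof -
  have "((\<lambda>h. (k h - k 0) / h) \<longlongrightarrow> D) (at_right 0)"
    using assms(1) by (auto simp: has_field_derivative_iff intro: tendsto_within_subset)
  then have "\<forall>\<^sub>F h in at_right 0. (k h - k 0) / h < e"
    using assms(2) by (rule order_tendstoD)
  moreover have "\<forall>\<^sub>F h in at_right 0. (0::real) < h"
    by (rule eventually_at_right_less)
  ultimately show ?thesis
    by eventually_elim (auto simp: field_simps)
qed

text \<open>The Dini form of the product rule for an integrating factor: \<open>D\<^sup>+ v \<le> b v\<close> gives
  \<open>D\<^sup>+ (exp (- b u) * v u) \<le> 0\<close>.\<close>

lemma dini_exp_weight: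
  fixes v :: "real \<Rightarrow> real"
  assumes "\<And>e. 0 < e \<Longrightarrow> \<forall>\<^sub>F h in at_right 0. v (u + h) \<le> v u + (b * v u + e) * h" and "0 < e"
  shows "\<forall>\<^sub>F h in at_right 0. exp (- b * (u + h)) * v (u + h) \<le> exp (- b * u) * v u + e * h"
proof -
  \<comment> \<open>\<open>k\<close> is the bound on the weighted function at \<open>u + h\<close>; with this slack its derivative at \<open>0\<close> is
    \<open>e / 2\<close>, which leaves room for the bound \<open>e * h\<close>.\<close>
  define e' where "e' = e * exp (b * u) / 2"
  define k where "k h = exp (- b * (u + h)) * (v u + (b * v u + e') * h)" for h
  have "exp (- b * u) * e' = e / 2"
    by (simp add: e'_def exp_minus field_simps)
  moreover have "(k has_real_derivative exp (- b * u) * e') (at 0)"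
    unfolding k_def by (auto intro!: derivative_eq_intros simp: algebra_simps)
  ultimately have "\<forall>\<^sub>F h in at_right 0. k h \<le> k 0 + e * h"
    using \<open>0 < e\<close> DERIV_imp_eventually_le[of k "exp (- b * u) * e'" e] by simp
  moreover have "\<forall>\<^sub>F h in at_right 0. v (u + h) \<le> v u + (b * v u + e') * h"
    using \<open>0 < e\<close> by (intro assms(1)) (simp add: e'_def)
  ultimately show ?thesis
  proof eventually_elim
    case (elim h)
    have "exp (- b * (u + h)) * v (u + h) \<le> k h"
      unfolding k_def using elim(2) by (intro mult_left_mono) auto
    also have "\<dots> \<le> k 0 + e * h" by (rule elim(1))
    finally show ?case by (simp add: k_def)
  qed
qed

text \<open>Otherwise, the last point at which \<open>G\<close> does not exceed its initial value would lie before \<open>t\<close>,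
  and \<open>G\<close> could not exceed that value immediately to the right of it either.\<close>

lemma nonincreasing_if_locally_right_nonincreasing:
  fixes G :: "real \<Rightarrow> real"
  assumes cont: "continuous_on {s..t} G" and "s \<le> t"
    and loc: "\<And>u. u \<in> {s..<t} \<Longrightarrow> \<forall>\<^sub>F h in at_right 0. G (u + h) \<le> G u"
  shows "G t \<le> G s"
proof (rule ccontr)
  assume neg: "\<not> G t \<le> G s"
  define K where "K = {u\<in>{s..t}. G u \<le> G s}"
  have "closed K"
    unfolding K_def
    by (intro continuous_on_closed_Collect_le cont continuous_on_const closed_real_atLeastAtMost)
  moreover have "bounded K"
    by (rule bounded_subset[OF bounded_closed_interval[of s t]]) (auto simp: K_def)
  ultimately have "compact K" by (simp add: compact_eq_bounded_closed)
  moreover have "s \<in> K" using \<open>s \<le> t\<close> by (simp add: K_def)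
  ultimately obtain c where c: "c \<in> K" "\<And>u. u \<in> K \<Longrightarrow> u \<le> c"
    using compact_attains_sup[of K] by blast
  have "c \<noteq> t" using c(1) neg by (auto simp: K_def)
  then have ct: "c \<in> {s..<t}" using c(1) by (auto simp: K_def)
  have "\<forall>\<^sub>F h in at_right 0. h < t - c"
    using ct by (auto simp: eventually_at_right_field intro!: exI[of _ "t - c"])
  moreover have "\<forall>\<^sub>F h in at_right 0. (0::real) < h"
    by (rule eventually_at_right_less)
  ultimately have "\<forall>\<^sub>F h in at_right (0::real). False"
    using loc[OF ct]
  proof eventually_elim
    case (elim h)
    then have "c + h \<in> K" using c(1) by (auto simp: K_def)
    with c(2) elim show ?case by fastforce
  qed
  then show False by simp
qed

text \<open>Cover the exceptional null set by an open set \<open>U\<close> of measure less than \<open>e\<close>, let \<open>m u\<close> be the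
  measure of \<open>U \<inter> {s..u}\<close>, and consider \<open>G u = g u - L * m u - e * (u - s)\<close>. On \<open>U\<close> the
  function \<open>m\<close> grows with slope \<open>1\<close>, and this compensates the growth of \<open>g\<close>, which has Lipschitz
  constant \<open>L\<close>. Off the exceptional set the term \<open>e * (u - s)\<close> absorbs the slack in the Dini bound.
  Hence \<open>G\<close> is nonincreasing, and as \<open>m t \<le> e\<close> the claim follows by letting \<open>e\<close> tend to \<open>0\<close>.

  The Lipschitz condition cannot be weakened to continuity, as the Cantor function shows.\<close>

lemma nonincreasing_if_AE_dini_nonpos:
  fixes g :: "real \<Rightarrow> real"
  assumes lip: "L-lipschitz_on {s..t} g" and "s \<le> t"
    and ae: "AE u in lebesgue. u \<in> {s<..<t} \<longrightarrow> (\<forall>e>0. \<forall>\<^sub>F h in at_right 0. g (u + h) \<le> g u + e * h)"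
  shows "g t \<le> g s"
proof -
  have L: "0 \<le> L" using lip by (simp add: lipschitz_on_def)
  have main: "g t - L * e - e * (t - s) \<le> g s" if e: "0 < e" for e
  proof -
    from ae obtain E0 where E0: "E0 \<in> null_sets lebesgue"
      and good0: "\<And>u. u \<in> {s<..<t} - E0 \<Longrightarrow> \<forall>e>0. \<forall>\<^sub>F h in at_right 0. g (u + h) \<le> g u + e * h"
      by (auto elim!: AE_E3)
    \<comment> \<open>The hypothesis says nothing about the left endpoint, which is therefore counted as
      exceptional.\<close>
    define E where "E = insert s E0"
    have E: "E \<in> null_sets lebesgue"
      unfolding E_def using E0
      by (metis negligible_iff_null_sets negligible_insert)
    have good: "\<forall>\<^sub>F h in at_right 0. g (u + h) \<le> g u + e * h" if "u \<in> {s..<t} - E" for u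
      using good0[of u] that e by (auto simp: E_def)
    obtain U where U: "open U" "E \<subseteq> U" "U - E \<in> lmeasurable" "emeasure lebesgue (U - E) < ennreal e"
      using sets_lebesgue_outer_open[of E e] E e by auto
    have Us [measurable]: "U \<in> sets lebesgue" using U(1) by auto
    have "emeasure lebesgue U = emeasure lebesgue (U - E)"
      using E Us by (simp add: emeasure_Diff_null_set)
    then have eU: "emeasure lebesgue U < ennreal e" using U(4) by simp
    have Ulm: "U \<in> lmeasurable"
      using Us eU by (auto intro!: fmeasurableI simp: top.not_eq_extremum order.strict_trans2[OF _ top_greatest])
    have Umeas: "measure lebesgue U \<le> e"
      using eU e by (simp add: measure_def enn2real_leI less_imp_le)
    define m where "m u = measure lebesgue (U \<inter> {s..u})" for u
    have inc: "m w = m u + measure lebesgue (U \<inter> {u<..w})" if "s \<le> u" "u \<le> w" for u w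
    proof -
      have disj: "(U \<inter> {s..u}) \<inter> (U \<inter> {u<..w}) = {}" by auto
      have "U \<inter> {s..w} = (U \<inter> {s..u}) \<union> (U \<inter> {u<..w})" using that by auto
      moreover have "measure lebesgue ((U \<inter> {s..u}) \<union> (U \<inter> {u<..w})) = m u + measure lebesgue (U \<inter> {u<..w})"
        unfolding m_def using Ulm
        by (subst measure_Un3) (auto simp: disj intro!: fmeasurable_Int_fmeasurable)
      ultimately show ?thesis by (simp add: m_def)
    qed
    have m_lip: "m w - m u \<le> w - u" "m u \<le> m w" if "s \<le> u" "u \<le> w" for u w
    proof -
      have "measure lebesgue (U \<inter> {u<..w}) \<le> measure lebesgue {u..w}"
        by (intro measure_mono_fmeasurable) auto
      then show "m w - m u \<le> w - u" "m u \<le> m w" using inc[OF that] that by auto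
    qed
    have m_local: "\<forall>\<^sub>F h in at_right 0. m (u + h) = m u + h" if "u \<in> U" "s \<le> u" for u
    proof -
      obtain d where d: "0 < d" "ball u d \<subseteq> U" using U(1) \<open>u \<in> U\<close> by (meson openE)
      have "m (u + h) = m u + h" if "0 < h" "h < d" for h
      proof -
        have "{u<..u+h} \<subseteq> ball u d" using that by (auto simp: dist_real_def)
        then have "U \<inter> {u<..u+h} = {u<..u+h}" using d(2) by auto
        then show ?thesis using inc[of u "u+h"] \<open>s \<le> u\<close> that by simp
      qed
      then show ?thesis using d(1) by (auto simp: eventually_at_right_field)
    qed
    have m_cont: "continuous_on {s..t} m"
    proof (rule lipschitz_on_continuous_on)
      show "1-lipschitz_on {s..t} m"
      proof (rule lipschitz_onI)
        fix u w assume "u \<in> {s..t}" "w \<in> {s..t}"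
        then show "dist (m u) (m w) \<le> 1 * dist u w"
          using m_lip[of u w] m_lip[of w u] by (cases "u \<le> w") (auto simp: dist_real_def)
      qed simp
    qed
    define G where "G u = g u - L * m u - e * (u - s)" for u
    have "G t \<le> G s"
    proof (rule nonincreasing_if_locally_right_nonincreasing[OF _ \<open>s \<le> t\<close>])
      show "continuous_on {s..t} G"
        unfolding G_def by (intro continuous_intros lipschitz_on_continuous_on[OF lip] m_cont)
    next
      fix u assume u: "u \<in> {s..<t}"
      have pos: "\<forall>\<^sub>F h in at_right 0. (0::real) < h"
        by (rule eventually_at_right_less)
      have small: "\<forall>\<^sub>F h in at_right 0. h < t - u"
        using u by (auto simp: eventually_at_right_field intro!: exI[of _ "t - u"])
      show "\<forall>\<^sub>F h in at_right 0. G (u + h) \<le> G u"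
      proof (cases "u \<in> E")
        case True
        then have "u \<in> U" using U(2) by auto
        have "s \<le> u" using u by simp
        show ?thesis
          using m_local[OF \<open>u \<in> U\<close> \<open>s \<le> u\<close>] pos small
        proof eventually_elim
          case (elim h)
          have "\<bar>g (u + h) - g u\<bar> \<le> L * h"
            using lipschitz_onD[OF lip, of "u + h" u] elim u by (auto simp: dist_real_def)
          moreover have "0 \<le> e * h" using elim e by simp
          ultimately show ?case using elim by (simp add: G_def algebra_simps abs_le_iff)
        qed
      next
        case False
        then have "\<forall>\<^sub>F h in at_right 0. g (u + h) \<le> g u + e * h" using good u by blast
        then show ?thesis using pos
        proof eventually_elim
          case (elim h)
          have "L * m u \<le> L * m (u + h)" using m_lip(2)[of u "u + h"] L elim u by (intro mult_left_mono) auto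
          then show ?case using elim by (simp add: G_def algebra_simps)
        qed
      qed
    qed
    moreover have "m s = 0"
    proof -
      have "negligible (U \<inter> {s..s})"
        by (rule negligible_subset[OF negligible_sing[of s]]) auto
      then show ?thesis
        by (simp add: m_def negligible_iff_null_sets measure_eq_0_null_sets)
    qed
    moreover have "measure lebesgue (U \<inter> {s..t}) \<le> measure lebesgue U"
      using Ulm by (intro measure_mono_fmeasurable) auto
    then have "m t \<le> e"
      unfolding m_def using Umeas by (rule order_trans)
    then have "L * m t \<le> L * e" using L by (rule mult_left_mono)
    ultimately show ?thesis by (simp add: G_def)
  qed
  have "((\<lambda>e. g t - L * e - e * (t - s)) \<longlongrightarrow> g t - L * 0 - 0 * (t - s)) (at_right 0)"
    by (intro tendsto_diff tendsto_mult tendsto_const tendsto_ident_at)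
  then have "g t - L * 0 - 0 * (t - s) \<le> g s"
  proof (rule tendsto_upperbound)
    show "\<forall>\<^sub>F e in at_right 0. g t - L * e - e * (t - s) \<le> g s"
      using eventually_at_right_less[of 0] by eventually_elim (rule main)
  qed simp
  then show ?thesis by simp
qed

section \<open>Peano's existence theorem\<close>

lemma continuous_on_integrand:
  assumes "continuous_on ({a..c} \<times> UNIV) (\<lambda>(t, x). f t x)" "continuous_on {a..c} y"
  shows "continuous_on {a..c} (\<lambda>s. f s (y s))"
proof -
  have "continuous_on {a..c} (\<lambda>s. (s, y s))"
    by (intro continuous_intros assms(2))
  from continuous_on_compose2[OF assms(1) this] show ?thesis by auto
qed

lemma norm_integral_diff_le:
  fixes g :: "real \<Rightarrow> 'a::banach"
  assumes g: "continuous_on {a..c} g" and M: "\<And>s. s \<in> {a..c} \<Longrightarrow> norm (g s) \<le> M"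
    and p: "p \<in> {a..c}" and q: "q \<in> {a..c}"
  shows "norm (integral {a..p} g - integral {a..q} g) \<le> M * \<bar>p - q\<bar>"
proof -
  have *: "norm (integral {a..p} g - integral {a..q} g) \<le> M * (p - q)"
    if "a \<le> q" "q \<le> p" "p \<le> c" for p q
  proof -
    have "g integrable_on {a..p}"
      using that by (intro integrable_continuous_real continuous_on_subset[OF g]) auto
    then have "integral {a..p} g - integral {a..q} g = integral {q..p} g"
      using Henstock_Kurzweil_Integration.integral_combine[of a q p g] that
      by (simp add: algebra_simps)
    moreover have "norm (integral {q..p} g) \<le> M * (p - q)"
      using that by (intro integral_bound M continuous_on_subset[OF g]) auto
    ultimately show ?thesis by simp
  qed
  show ?thesis
    using *[of q p] *[of p q] p q by (cases "q \<le> p") (auto simp: norm_minus_commute)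
qed

text \<open>Tonelli's approximation. The equation with delay \<open>d\<close> determines its solution step by step: the
  \<open>k\<close>-th Picard iterate no longer changes on \<open>[a, a + k d]\<close>, so finitely many iterations reach an
  exact solution on the whole interval. The Lipschitz constant \<open>M\<close> does not depend on \<open>d\<close>, which
  provides the equicontinuity needed to let the delay tend to \<open>0\<close>.\<close>

lemma delayed_integral_equation:
  fixes f :: "real \<Rightarrow> 'a::euclidean_space \<Rightarrow> 'a"
  assumes f: "continuous_on ({a..c} \<times> UNIV) (\<lambda>(t, x). f t x)"
    and M: "\<And>t x. t \<in> {a..c} \<Longrightarrow> norm (f t x) \<le> M"
    and ac: "a \<le> c" and d: "0 < d"
  obtains y where "M-lipschitz_on {a..c} y"
    "\<And>t. t \<in> {a..c} \<Longrightarrow> y t = x0 + integral {a..max a (t - d)} (\<lambda>s. f s (y s))"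
proof -
  have M0: "0 \<le> M" using order_trans[OF norm_ge_zero M[of a x0]] ac by simp
  define Y where "Y = rec_nat (\<lambda>_. x0)
    (\<lambda>_ y t. x0 + integral {a..max a (t - d)} (\<lambda>s. f s (y s)))"
  have Y0: "Y 0 = (\<lambda>_. x0)"
    and YS: "Y (Suc k) = (\<lambda>t. x0 + integral {a..max a (t - d)} (\<lambda>s. f s (Y k s)))" for k
    by (simp_all add: Y_def)
  have lip: "M-lipschitz_on {a..c} (Y k)" for k
  proof (induction k)
    case 0
    then show ?case using M0 by (simp add: Y0 lipschitz_on_def)
  next
    case (Suc k)
    have cont: "continuous_on {a..c} (\<lambda>s. f s (Y k s))"
      by (rule continuous_on_integrand[OF f lipschitz_on_continuous_on[OF Suc]])
    show ?case
    proof (rule lipschitz_onI[OF _ M0])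
      fix t u assume tu: "t \<in> {a..c}" "u \<in> {a..c}"
      let ?p = "max a (t - d)" and ?q = "max a (u - d)"
      have "dist (Y (Suc k) t) (Y (Suc k) u)
          = norm (integral {a..?p} (\<lambda>s. f s (Y k s)) - integral {a..?q} (\<lambda>s. f s (Y k s)))"
        by (simp add: YS dist_norm)
      also have "\<dots> \<le> M * \<bar>?p - ?q\<bar>"
        using tu d by (intro norm_integral_diff_le[OF cont] M) auto
      also have "\<dots> \<le> M * \<bar>t - u\<bar>"
        using M0 by (intro mult_left_mono) auto
      finally show "dist (Y (Suc k) t) (Y (Suc k) u) \<le> M * dist t u"
        by (simp add: dist_real_def)
    qed
  qed
  have stable: "Y (Suc k) t = Y k t" if "t \<in> {a..c}" "t \<le> a + real k * d" for k t
    using that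
  proof (induction k arbitrary: t)
    case 0
    then show ?case using d by (simp add: YS Y0 max_def)
  next
    case (Suc k)
    have "integral {a..max a (t - d)} (\<lambda>s. f s (Y (Suc k) s))
        = integral {a..max a (t - d)} (\<lambda>s. f s (Y k s))"
    proof (rule Henstock_Kurzweil_Integration.integral_cong)
      fix s assume s: "s \<in> {a..max a (t - d)}"
      have "0 \<le> real k * d" using d by simp
      then have "Y (Suc k) s = Y k s"
        using s Suc.prems d ac by (intro Suc.IH) (auto simp: max_def algebra_simps split: if_splits)
      then show "f s (Y (Suc k) s) = f s (Y k s)" by simp
    qed
    then show ?case by (simp add: YS)
  qed
  obtain k :: nat where k: "(c - a) / d \<le> real k" using real_arch_simple by blast
  then have "c \<le> a + real k * d" using d by (simp add: field_simps)
  then have "Y k t = x0 + integral {a..max a (t - d)} (\<lambda>s. f s (Y k s))" if "t \<in> {a..c}" for t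
    using stable[of t k] that by (simp add: YS)
  with lip that show ?thesis by blast
qed

text \<open>By the Arzela-Ascoli theorem, a sequence of solutions with delays \<open>1 / (n + 1)\<close> has a
  subsequence that converges uniformly. Its limit solves the integral equation without delay,
  because ignoring the delay changes the integral by at most \<open>M / (n + 1)\<close>.\<close>

lemma peano_bounded:
  fixes f :: "real \<Rightarrow> 'a::euclidean_space \<Rightarrow> 'a"
  assumes f: "continuous_on ({a..c} \<times> UNIV) (\<lambda>(t, x). f t x)"
    and M: "\<And>t x. t \<in> {a..c} \<Longrightarrow> norm (f t x) \<le> M"
    and ac: "a \<le> c"
  obtains y where "y a = x0"
    "\<And>t. t \<in> {a..c} \<Longrightarrow> (y has_vector_derivative f t (y t)) (at t within {a..c})"
proof -
  have M0: "0 \<le> M" using order_trans[OF norm_ge_zero M[of a x0]] ac by simp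
  have "\<exists>y. M-lipschitz_on {a..c} y \<and>
      (\<forall>t\<in>{a..c}. y t = x0 + integral {a..max a (t - d)} (\<lambda>s. f s (y s)))" if "0 < d" for d
    using delayed_integral_equation[OF f M ac that, of x0] by metis
  then have "\<exists>y. \<forall>n::nat. M-lipschitz_on {a..c} (y n) \<and>
      (\<forall>t\<in>{a..c}. y n t = x0 + integral {a..max a (t - inverse (real (Suc n)))} (\<lambda>s. f s (y n s)))"
    by (intro choice allI) simp
  then obtain Y where lip: "\<And>n::nat. M-lipschitz_on {a..c} (Y n)"
    and eq: "\<And>n t. t \<in> {a..c} \<Longrightarrow>
      Y n t = x0 + integral {a..max a (t - inverse (real (Suc n)))} (\<lambda>s. f s (Y n s))"
    by blast
  have cont: "continuous_on {a..c} (\<lambda>s. f s (Y n s))" for n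
    by (rule continuous_on_integrand[OF f lipschitz_on_continuous_on[OF lip]])
  have start: "Y n a = x0" for n
    using eq[of a n] ac by (simp add: max_def)
  obtain y k where y: "continuous_on {a..c} y" and k: "strict_mono (k :: nat \<Rightarrow> nat)"
    and unif: "\<And>e. 0 < e \<Longrightarrow> \<exists>N. \<forall>n t. n \<ge> N \<and> t \<in> {a..c} \<longrightarrow> norm (Y (k n) t - y t) < e"
  proof (rule Arzela_Ascoli[of "{a..c}" Y "norm x0 + M * (c - a)"])
    fix n t assume t: "t \<in> {a..c}"
    have "norm (Y n t - x0) \<le> M * (t - a)"
      using lipschitz_onD[OF lip t, of a n] t by (simp add: start dist_norm dist_real_def)
    also have "\<dots> \<le> M * (c - a)" using t M0 by (intro mult_left_mono) auto
    finally show "norm (Y n t) \<le> norm x0 + M * (c - a)"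
      using norm_triangle_sub[of "Y n t" x0] by simp
  next
    fix t e :: real assume t: "t \<in> {a..c}" and e: "0 < e"
    have "norm (Y n t - Y n u) < e" if "u \<in> {a..c}" "norm (t - u) < e / (M + 1)" for n u
    proof -
      have "norm (Y n t - Y n u) \<le> M * norm (t - u)"
        using lipschitz_onD[OF lip t that(1)] by (simp add: dist_norm)
      also have "\<dots> \<le> (M + 1) * norm (t - u)" by (simp add: algebra_simps)
      also have "\<dots> < e" using that(2) M0 by (simp add: field_simps)
      finally show ?thesis .
    qed
    then show "\<exists>d>0. \<forall>n u. u \<in> {a..c} \<and> norm (t - u) < d \<longrightarrow> norm (Y n t - Y n u) < e"
      using e M0 by (intro exI[of _ "e / (M + 1)"]) auto
  qed (auto intro: that)
  have ptw: "(\<lambda>n. Y (k n) t) \<longlonglongrightarrow> y t" if "t \<in> {a..c}" for t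
    using unif that unfolding LIMSEQ_iff by meson
  have fy: "continuous_on {a..c} (\<lambda>s. f s (y s))"
    by (rule continuous_on_integrand[OF f y])
  have inty: "y t = x0 + integral {a..t} (\<lambda>s. f s (y s))" if t: "t \<in> {a..c}" for t
  proof -
    have sub: "{a..t} \<subseteq> {a..c}" using t by auto
    have "(\<lambda>n. integral {a..t} (\<lambda>s. f s (Y (k n) s))) \<longlonglongrightarrow> integral {a..t} (\<lambda>s. f s (y s))"
    proof (rule dominated_convergence(2)[where h = "\<lambda>_. M"])
      show "(\<lambda>s. f s (Y (k n) s)) integrable_on {a..t}" for n
        by (intro integrable_continuous_real continuous_on_subset[OF cont sub])
      fix s assume s: "s \<in> {a..t}"
      then have s': "s \<in> {a..c}" using sub by auto
      show "norm (f s (Y (k n) s)) \<le> M" for n by (rule M[OF s'])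
      have "continuous_on UNIV (Pair s :: 'a \<Rightarrow> _)" by (intro continuous_intros)
      from continuous_on_compose2[OF f this] have "continuous_on UNIV (f s)"
        using s' by (simp add: image_subset_iff)
      then show "(\<lambda>n. f s (Y (k n) s)) \<longlonglongrightarrow> f s (y s)"
        using ptw[OF s'] by (auto simp: continuous_on_def intro: tendsto_compose)
    qed (rule integrable_const_ivl)
    moreover have "(\<lambda>n. integral {a..max a (t - inverse (real (Suc (k n))))} (\<lambda>s. f s (Y (k n) s))
          - integral {a..t} (\<lambda>s. f s (Y (k n) s))) \<longlonglongrightarrow> 0"
    proof (rule Lim_null_comparison)
      show "\<forall>\<^sub>F n in sequentially.
          norm (integral {a..max a (t - inverse (real (Suc (k n))))} (\<lambda>s. f s (Y (k n) s))
            - integral {a..t} (\<lambda>s. f s (Y (k n) s))) \<le> M * inverse (real (Suc (k n)))"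
      proof (intro always_eventually allI)
        fix n
        let ?d = "inverse (real (Suc (k n)))"
        have d: "0 < ?d" by simp
        have "norm (integral {a..max a (t - ?d)} (\<lambda>s. f s (Y (k n) s))
            - integral {a..t} (\<lambda>s. f s (Y (k n) s))) \<le> M * \<bar>max a (t - ?d) - t\<bar>"
        proof (rule norm_integral_diff_le[OF cont M _ t])
          have "t - ?d \<le> c" using t d unfolding atLeastAtMost_iff by linarith
          then show "max a (t - ?d) \<in> {a..c}" using t by simp
        qed
        also have "\<dots> \<le> M * ?d"
          using t d M0 by (intro mult_left_mono) auto
        finally show "norm (integral {a..max a (t - ?d)} (\<lambda>s. f s (Y (k n) s))
            - integral {a..t} (\<lambda>s. f s (Y (k n) s))) \<le> M * ?d" .
      qed
      have "(\<lambda>n. inverse (real (Suc (k n)))) \<longlonglongrightarrow> 0"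
        using LIMSEQ_subseq_LIMSEQ[OF LIMSEQ_inverse_real_of_nat k] by (simp add: o_def)
      from tendsto_mult_right_zero[OF this]
      show "(\<lambda>n. M * inverse (real (Suc (k n)))) \<longlonglongrightarrow> 0" .
    qed
    ultimately have "(\<lambda>n. x0 + (integral {a..max a (t - inverse (real (Suc (k n))))} (\<lambda>s. f s (Y (k n) s))
          - integral {a..t} (\<lambda>s. f s (Y (k n) s))) + integral {a..t} (\<lambda>s. f s (Y (k n) s)))
        \<longlonglongrightarrow> x0 + 0 + integral {a..t} (\<lambda>s. f s (y s))"
      by (intro tendsto_add tendsto_const)
    then have "(\<lambda>n. Y (k n) t) \<longlonglongrightarrow> x0 + integral {a..t} (\<lambda>s. f s (y s))"
      by (simp add: eq[OF t])
    with ptw[OF t] show ?thesis by (rule LIMSEQ_unique)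
  qed
  show ?thesis
  proof
    show "y a = x0" using inty[of a] ac by simp
    fix t assume t: "t \<in> {a..c}"
    have "((\<lambda>u. x0 + integral {a..u} (\<lambda>s. f s (y s))) has_vector_derivative 0 + f t (y t)) (at t within {a..c})"
      by (intro has_vector_derivative_add has_vector_derivative_const
          integral_has_vector_derivative[OF fy t])
    then show "(y has_vector_derivative f t (y t)) (at t within {a..c})"
      using inty by (auto intro: has_vector_derivative_transform[OF t])
  qed
qed

text \<open>Composing \<open>f t\<close> with the projection onto the closed unit ball around \<open>x0\<close> makes the field
  bounded; a solution for the modified field stays in that ball for a short time, and there the two
  fields agree.\<close>

lemma peano_local:
  fixes f :: "real \<Rightarrow> 'a::euclidean_space \<Rightarrow> 'a"
  assumes f: "continuous_on ({a..} \<times> UNIV) (\<lambda>(t, x). f t x)"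
  obtains d y where "0 < d" "y a = x0"
    "\<And>t. t \<in> {a..a + d} \<Longrightarrow> (y has_vector_derivative f t (y t)) (at t within {a..a + d})"
proof -
  define P where "P = closest_point (cball x0 1)"
  define g where "g t x = f t (P x)" for t x
  have P_in: "P x \<in> cball x0 1" for x
    unfolding P_def by (rule closest_point_in_set) auto
  have P_id: "P x = x" if "x \<in> cball x0 1" for x
    unfolding P_def using that by (rule closest_point_self)
  have P_cont: "continuous_on UNIV P"
    unfolding P_def by (intro continuous_on_closest_point) auto
  have cont: "continuous_on ({a..a + 1} \<times> UNIV) (\<lambda>(t, x). g t x)"
  proof -
    have "continuous_on ({a..a + 1} \<times> UNIV) (\<lambda>z. (fst z, P (snd z)))"
      by (intro continuous_intros continuous_on_compose2[OF P_cont]) auto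
    then have "continuous_on ({a..a + 1} \<times> UNIV) (\<lambda>z. case (fst z, P (snd z)) of (t, x) \<Rightarrow> f t x)"
      by (rule continuous_on_compose2[OF f]) auto
    then show ?thesis by (simp add: g_def case_prod_beta)
  qed
  have "compact ((\<lambda>(t, x). f t x) ` ({a..a + 1} \<times> cball x0 1))"
    by (intro compact_continuous_image continuous_on_subset[OF f] compact_Times) auto
  then obtain M where M: "\<And>t x. t \<in> {a..a + 1} \<Longrightarrow> x \<in> cball x0 1 \<Longrightarrow> norm (f t x) \<le> M"
    by (fastforce dest!: compact_imp_bounded simp: bounded_iff)
  have gM: "norm (g t x) \<le> M" if "t \<in> {a..a + 1}" for t x
    unfolding g_def using that P_in by (rule M)
  obtain y where y0: "y a = x0"
    and y: "\<And>t. t \<in> {a..a + 1} \<Longrightarrow> (y has_vector_derivative g t (y t)) (at t within {a..a + 1})"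
    using peano_bounded[OF cont gM, of x0] by auto
  have "continuous_on {a..a + 1} y"
    using y by (meson continuous_on_eq_continuous_within has_vector_derivative_continuous)
  then have "(y \<longlongrightarrow> x0) (at a within {a..a + 1})"
    using y0 by (auto simp: continuous_on_def)
  then have "\<forall>\<^sub>F t in at a within {a..a + 1}. dist (y t) x0 < 1"
    by (rule tendstoD) simp
  then obtain e where e: "0 < e"
      "\<And>t. t \<in> {a..a + 1} \<Longrightarrow> t \<noteq> a \<Longrightarrow> dist t a < e \<Longrightarrow> dist (y t) x0 < 1"
    by (auto simp: eventually_at)
  define d where "d = min 1 (e / 2)"
  have d: "0 < d" "d \<le> 1" "d < e" using e(1) by (auto simp: d_def)
  show ?thesis
  proof
    show "0 < d" by (rule d(1))
    show "y a = x0" by (rule y0)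
    fix t assume t: "t \<in> {a..a + d}"
    have "y t \<in> cball x0 1"
      using e(2)[of t] t d y0 by (cases "t = a") (auto simp: dist_real_def dist_commute)
    then have "g t (y t) = f t (y t)" by (simp add: g_def P_id)
    then show "(y has_vector_derivative f t (y t)) (at t within {a..a + d})"
      using has_vector_derivative_within_subset[OF y, of t "{a..a + d}"] t d by auto
  qed
qed

section \<open>Induced and logarithmic matrix norms\<close>

lemma unit_sphere_nonempty:
  fixes N :: "real^'n \<Rightarrow> real"
  assumes N: "is_norm N"
  shows "{x. N x = 1} \<noteq> {}"
proof -
  obtain z :: "real^'n" where "z \<noteq> 0" using nonempty_Basis nonzero_Basis by blast
  then have "0 < N z" using N by (auto simp: is_norm_def less_le)
  then have "N ((1 / N z) *\<^sub>R z) = 1"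
    by (simp add: seminorm_scaleR[OF is_norm_imp_seminorm[OF N]])
  then show ?thesis by blast
qed

lemma bdd_above_matrix_image:
  fixes N :: "real^'n \<Rightarrow> real"
  assumes N: "is_norm N"
  shows "bdd_above ((\<lambda>x. N (A *v x)) ` {x. N x = 1})"
proof -
  obtain K where K: "0 < K" "\<And>x. N x \<le> K * norm x" using is_norm_le_norm[OF N] by blast
  obtain c where c: "0 < c" "\<And>x. c * norm x \<le> N x" using norm_le_is_norm[OF N] by blast
  show ?thesis
  proof (rule bdd_aboveI2)
    fix x assume "x \<in> {x. N x = 1}"
    then have x: "norm x \<le> 1 / c" using c(2)[of x] c(1) by (simp add: field_simps)
    have "N (A *v x) \<le> K * norm (A *v x)" by (rule K(2))
    also have "\<dots> \<le> K * (onorm ((*v) A) * norm x)"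
      using K(1) by (intro mult_left_mono onorm) (auto simp: matrix_vector_mul_bounded_linear)
    also have "\<dots> \<le> K * (onorm ((*v) A) * (1 / c))"
      using K(1) x by (intro mult_left_mono) (auto simp: onorm_pos_le matrix_vector_mul_bounded_linear)
    finally show "N (A *v x) \<le> K * (onorm ((*v) A) * (1 / c))" .
  qed
qed

text \<open>That \<open>induced_norm\<close> really bounds the action of the matrix depends on the supremum being over a
  bounded set, which is where the equivalence of norms enters.\<close>

lemma induced_norm_bound:
  fixes N :: "real^'n \<Rightarrow> real"
  assumes N: "is_norm N"
  shows "N (A *v x) \<le> induced_norm N A * N x"
proof (cases "x = 0")
  case True
  then show ?thesis by (simp add: seminorm_zero[OF is_norm_imp_seminorm[OF N]])
next
  case False
  note sn = is_norm_imp_seminorm[OF N]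
  have pos: "0 < N x" using N False by (auto simp: is_norm_def less_le)
  then have "N ((1 / N x) *\<^sub>R x) = 1" by (simp add: seminorm_scaleR[OF sn])
  then have "N (A *v ((1 / N x) *\<^sub>R x)) \<le> induced_norm N A"
    unfolding induced_norm_def by (intro cSUP_upper bdd_above_matrix_image N) simp
  then have "N (A *v x) / N x \<le> induced_norm N A"
    using pos by (simp add: matrix_vector_mult_scaleR seminorm_scaleR[OF sn])
  then show ?thesis using pos by (simp add: field_simps)
qed

lemma induced_norm_least:
  fixes N :: "real^'n \<Rightarrow> real"
  assumes N: "is_norm N" and "\<And>x. N x = 1 \<Longrightarrow> N (A *v x) \<le> B"
  shows "induced_norm N A \<le> B"
  unfolding induced_norm_def by (rule cSUP_least[OF unit_sphere_nonempty[OF N]]) (use assms in auto)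

lemma induced_norm_one:
  fixes N :: "real^'n \<Rightarrow> real"
  assumes N: "is_norm N"
  shows "induced_norm N (mat 1) = 1"
proof (rule antisym)
  obtain x where "N x = 1" using unit_sphere_nonempty[OF N] by blast
  then show "1 \<le> induced_norm N (mat 1)" using induced_norm_bound[OF N, of "mat 1" x] by simp
qed (auto intro: induced_norm_least[OF N])

lemma seminorm_induced_norm:
  fixes N :: "real^'n \<Rightarrow> real"
  assumes N: "is_norm N"
  shows "seminorm (induced_norm N)"
  unfolding seminorm_def
proof (intro conjI allI)
  note sn = is_norm_imp_seminorm[OF N]
  have bound: "N (A *v x) \<le> induced_norm N A" if "N x = 1" for A x
    using induced_norm_bound[OF N, of A x] that by simp
  have scale_le: "induced_norm N (a *\<^sub>R A) \<le> \<bar>a\<bar> * induced_norm N A" for a A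
  proof (rule induced_norm_least[OF N])
    fix x assume "N x = 1"
    then show "N ((a *\<^sub>R A) *v x) \<le> \<bar>a\<bar> * induced_norm N A"
      using bound[of x A]
      by (simp add: scaleR_matrix_vector_assoc[symmetric] seminorm_scaleR[OF sn] mult_left_mono)
  qed
  have nonneg: "0 \<le> induced_norm N A" for A
  proof -
    obtain x where "N x = 1" using unit_sphere_nonempty[OF N] by blast
    then show ?thesis using bound[of x A] N by (meson is_norm_def order_trans)
  qed
  show "induced_norm N (a *\<^sub>R A) = \<bar>a\<bar> * induced_norm N A" for a A
  proof (cases "a = 0")
    case True
    then show ?thesis using scale_le[of 0 A] nonneg[of 0] by simp
  next
    case False
    have "\<bar>a\<bar> * induced_norm N A \<le> induced_norm N (a *\<^sub>R A)"
      using scale_le[of "inverse a" "a *\<^sub>R A"] False by (simp add: field_simps)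
    with scale_le show ?thesis by (intro antisym)
  qed
  show "induced_norm N (A + B) \<le> induced_norm N A + induced_norm N B" for A B
  proof (rule induced_norm_least[OF N])
    fix x assume "N x = 1"
    then show "N ((A + B) *v x) \<le> induced_norm N A + induced_norm N B"
      using seminorm_triangle[OF sn, of "A *v x" "B *v x"] bound[of x A] bound[of x B]
      by (simp add: matrix_vector_mult_add_rdistrib)
  qed
qed

text \<open>Compare the difference quotients before the limit:
  \<open>y + h *\<^sub>R (A *v y)\<close> is the image of \<open>y\<close> under \<open>mat 1 + h *\<^sub>R A\<close>.\<close>

lemma norm_derivative_le_log_norm:
  fixes N :: "real^'n \<Rightarrow> real"
  assumes N: "is_norm N"
  shows "Lim (at_right 0) (\<lambda>h. (N (y + h *\<^sub>R (A *v y)) - N y) / h) \<le> log_norm N A * N y"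
proof (rule tendsto_le[OF trivial_limit_at_right_real])
  show "((\<lambda>h. (N (y + h *\<^sub>R (A *v y)) - N y) / h) \<longlongrightarrow>
      Lim (at_right 0) (\<lambda>h. (N (y + h *\<^sub>R (A *v y)) - N y) / h)) (at_right 0)"
    by (rule seminorm_quotient_Lim[OF is_norm_imp_seminorm[OF N]])
  show "((\<lambda>h. (induced_norm N (mat 1 + h *\<^sub>R A) - 1) / h * N y) \<longlongrightarrow> log_norm N A * N y) (at_right 0)"
    using seminorm_quotient_Lim[OF seminorm_induced_norm[OF N], of "mat 1" A]
    by (intro tendsto_mult tendsto_const) (simp add: induced_norm_one[OF N] log_norm_def)
  show "\<forall>\<^sub>F h in at_right 0. (N (y + h *\<^sub>R (A *v y)) - N y) / h
      \<le> (induced_norm N (mat 1 + h *\<^sub>R A) - 1) / h * N y"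
    using eventually_at_right_less[of 0]
  proof eventually_elim
    case (elim h)
    have "y + h *\<^sub>R (A *v y) = (mat 1 + h *\<^sub>R A) *v y"
      by (simp add: matrix_vector_mult_add_rdistrib scaleR_matrix_vector_assoc)
    then have "N (y + h *\<^sub>R (A *v y)) \<le> induced_norm N (mat 1 + h *\<^sub>R A) * N y"
      using induced_norm_bound[OF N] by metis
    then show ?case using elim by (simp add: field_simps)
  qed
qed

lemma log_norm_imp_one_sided_bound:
  fixes N :: "real^'n \<Rightarrow> real"
  assumes N: "is_norm N" and D: "deimling_inequality N W"
    and f: "\<And>t x. 0 \<le> t \<Longrightarrow> x \<in> C \<Longrightarrow> f t x = A t x *v (x - xs)"
    and mu: "\<And>t x. 0 \<le> t \<Longrightarrow> x \<in> C \<Longrightarrow> log_norm N (A t x) \<le> b"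
  shows "one_sided_bound f W N C xs b"
  unfolding one_sided_bound_def
proof (intro ballI allI impI)
  fix x and t :: real assume x: "x \<in> C" and t: "0 \<le> t"
  let ?y = "x - xs"
  have nn: "0 \<le> N ?y" using N by (simp add: is_norm_def)
  have "W (f t x) ?y \<le> N ?y * Lim (at_right 0) (\<lambda>h. (N (?y + h *\<^sub>R (A t x *v ?y)) - N ?y) / h)"
    using D by (simp add: deimling_inequality_def f[OF t x])
  also have "\<dots> \<le> N ?y * (log_norm N (A t x) * N ?y)"
    by (intro mult_left_mono norm_derivative_le_log_norm N nn)
  also have "\<dots> \<le> N ?y * (b * N ?y)"
    by (intro mult_left_mono mult_right_mono mu t x nn)
  finally show "W (f t x) ?y \<le> b * (N ?y)\<^sup>2" by (simp add: power2_eq_square mult_ac)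
qed

section \<open>The three decay conditions\<close>

lemma right_derivative_remainder:
  fixes y :: "real \<Rightarrow> 'a::real_normed_vector"
  assumes y: "(y has_vector_derivative D) (at u within S)" and S: "{u..u + d} \<subseteq> S" "0 < d" and "0 < e"
  shows "\<forall>\<^sub>F h in at_right 0. norm (y (u + h) - y u - h *\<^sub>R D) \<le> e * h"
proof -
  obtain r where r: "0 < r"
      "\<And>w. w \<in> S \<Longrightarrow> norm (w - u) < r \<Longrightarrow> norm (y w - y u - (w - u) *\<^sub>R D) \<le> e * norm (w - u)"
    using y \<open>0 < e\<close> unfolding has_vector_derivative_def has_derivative_within_alt by blast
  have "norm (y (u + h) - y u - h *\<^sub>R D) \<le> e * h" if "0 < h" "h < min r d" for h
  proof -
    have "u + h \<in> S" using S that by (intro subsetD[OF S(1)]) auto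
    then show ?thesis using r(2)[of "u + h"] that by simp
  qed
  then show ?thesis
    using r(1) S by (auto simp: eventually_at_right_field intro!: exI[of _ "min r d"])
qed

text \<open>The decay estimate from \<open>t\<close> to \<open>t + h\<close> bounds the difference quotient by
  \<open>(exp (b * h) - 1) / h\<close> times the norm, and the factor tends to \<open>b\<close>.\<close>

lemma exponential_decay_imp_dini_decay:
  assumes "exponential_decay f N C xs b"
  shows "dini_decay f N C xs b"
  unfolding dini_decay_def
proof (intro allI impI)
  fix t0 x0 T \<phi> t
  assume sol: "0 \<le> t0 \<and> x0 \<in> C \<and> is_solution f t0 x0 T \<phi>" and t: "t0 \<le> t \<and> ereal t < T"
  let ?v = "\<lambda>s. N (\<phi> s - xs)"
  have dec: "?v t' \<le> exp (b * (t' - t)) * ?v t" if "t \<le> t'" "ereal t' < T" for t'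
    using assms sol t that unfolding exponential_decay_def by blast
  obtain d where d: "0 < d" "ereal (t + d) < T"
  proof -
    obtain r where "ereal t < ereal r" "ereal r < T" using t ereal_dense2 by blast
    then show ?thesis using that[of "r - t"] by simp
  qed
  show "upper_right_dini ?v t \<le> ereal (b * ?v t)"
  proof (rule upper_right_dini_leI)
    have "?v (t + h) \<le> ?v t + (exp (b * h) - 1) / h * ?v t * h" if "0 < h" "h < d" for h
    proof -
      have "ereal (t + h) < T" using that d(2) by (metis add_less_cancel_left less_ereal.simps(1) order.strict_trans)
      then show ?thesis using dec[of "t + h"] that by (simp add: field_simps)
    qed
    then show "\<forall>\<^sub>F h in at_right 0. ?v (t + h) \<le> ?v t + (exp (b * h) - 1) / h * ?v t * h"
      using d(1) by (auto simp: eventually_at_right_field intro!: exI[of _ d])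
    have "((\<lambda>h. exp (b * h)) has_real_derivative b) (at 0)"
      by (auto intro!: derivative_eq_intros)
    then have "((\<lambda>h. (exp (b * h) - 1) / h) \<longlongrightarrow> b) (at_right 0)"
      by (auto simp: has_field_derivative_iff intro: tendsto_within_subset)
    then show "((\<lambda>h. (exp (b * h) - 1) / h * ?v t) \<longlongrightarrow> b * ?v t) (at_right 0)"
      by (intro tendsto_intros)
  qed
qed

text \<open>A solution started in \<open>x\<close> differs from the straight line \<open>x + h *\<^sub>R f t x\<close> by \<open>o(h)\<close>, so the
  Dini bound along the solution passes to the derivative of the norm along the line, which is the
  limit in Deimling's inequality.\<close>

lemma dini_decay_imp_one_sided_bound:
  fixes f :: "real \<Rightarrow> 'a::euclidean_space \<Rightarrow> 'a"
  assumes f: "continuous_on ({0..} \<times> UNIV) (\<lambda>(t, x). f t x)"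
    and N: "is_norm N" and D: "deimling_inequality N W" and dd: "dini_decay f N C xs b"
  shows "one_sided_bound f W N C xs b"
  unfolding one_sided_bound_def
proof (intro ballI allI impI)
  fix x and t :: real assume x: "x \<in> C" and t: "0 \<le> t"
  let ?y = "x - xs"
  note sn = is_norm_imp_seminorm[OF N]
  obtain K where K: "0 < K" "\<And>x. N x \<le> K * norm x" using is_norm_le_norm[OF N] by blast
  have "continuous_on ({t..} \<times> UNIV) (\<lambda>(t, x). f t x)"
    by (rule continuous_on_subset[OF f]) (use t in auto)
  then obtain d \<phi> where d: "0 < d" and start: "\<phi> t = x"
    and der: "\<And>u. u \<in> {t..t + d} \<Longrightarrow> (\<phi> has_vector_derivative f u (\<phi> u)) (at u within {t..t + d})"
    using peano_local[of t f x] by blast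
  have "is_solution f t x (ereal (t + d)) \<phi>"
    unfolding is_solution_def
    using d start by (auto intro!: has_vector_derivative_within_subset[OF der])
  then have dini: "upper_right_dini (\<lambda>s. N (\<phi> s - xs)) t \<le> ereal (b * N ?y)"
    using dd x t d start unfolding dini_decay_def by fastforce
  let ?L = "Lim (at_right 0) (\<lambda>h. (N (?y + h *\<^sub>R f t x) - N ?y) / h)"
  have "?L \<le> b * N ?y + e" if e: "0 < e" for e
  proof (rule tendsto_upperbound[OF seminorm_quotient_Lim[OF sn]])
    have "\<forall>\<^sub>F h in at_right 0. norm (\<phi> (t + h) - \<phi> t - h *\<^sub>R f t (\<phi> t)) \<le> (e / (2 * K)) * h"
      using d e K(1) der[of t] by (intro right_derivative_remainder[where S = "{t..t + d}" and d = d]) auto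
    moreover have "\<forall>\<^sub>F h in at_right 0. N (\<phi> (t + h) - xs) \<le> N (\<phi> t - xs) + (b * N ?y + e / 2) * h"
      using upper_right_dini_leD[OF dini, of "e / 2"] e by simp
    ultimately show "\<forall>\<^sub>F h in at_right 0. (N (?y + h *\<^sub>R f t x) - N ?y) / h \<le> b * N ?y + e"
      using eventually_at_right_less[of 0]
    proof eventually_elim
      case (elim h)
      let ?r = "\<phi> (t + h) - x - h *\<^sub>R f t x"
      have "N (?y + h *\<^sub>R f t x) = N ((\<phi> (t + h) - xs) + - ?r)" by (simp add: algebra_simps)
      also have "\<dots> \<le> N (\<phi> (t + h) - xs) + N ?r"
        using seminorm_triangle[OF sn, of "\<phi> (t + h) - xs" "- ?r"] unfolding seminorm_minus[OF sn] .
      also have "N ?r \<le> K * norm ?r" by (rule K(2))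
      also have "\<dots> \<le> K * ((e / (2 * K)) * h)"
        using elim(1) K(1) start by (intro mult_left_mono) auto
      also have "\<dots> = e / 2 * h" using K(1) by simp
      finally have "N (?y + h *\<^sub>R f t x) \<le> N ?y + (b * N ?y + e) * h"
        using elim(2) start by (simp add: algebra_simps)
      then show ?case using elim(3) by (simp add: field_simps)
    qed
  qed simp
  then have L: "?L \<le> b * N ?y" by (rule field_le_epsilon)
  have "W (f t x) ?y \<le> N ?y * ?L" using D by (simp add: deimling_inequality_def)
  also have "\<dots> \<le> N ?y * (b * N ?y)"
    using L N by (intro mult_left_mono) (auto simp: is_norm_def)
  finally show "W (f t x) ?y \<le> b * (N ?y)\<^sup>2" by (simp add: power2_eq_square mult_ac)
qed

lemma lipschitz_on_vector_derivative:
  fixes y :: "real \<Rightarrow> 'a::real_normed_vector"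
  assumes y: "\<And>u. u \<in> {s..t} \<Longrightarrow> (y has_vector_derivative y' u) (at u within {s..t})"
    and y': "continuous_on {s..t} y'"
  obtains B where "B-lipschitz_on {s..t} y"
proof -
  have "bounded (y' ` {s..t})"
    by (intro compact_imp_bounded compact_continuous_image y' compact_Icc)
  then obtain B where B: "0 < B" "\<And>u. u \<in> {s..t} \<Longrightarrow> norm (y' u) \<le> B"
    by (auto simp: bounded_pos)
  have "B-lipschitz_on {s..t} y"
  proof (rule lipschitz_onI)
    fix u w assume uw: "u \<in> {s..t}" "w \<in> {s..t}"
    have "norm (y u - y w) \<le> B * norm (u - w)"
    proof (rule differentiable_bound[where S = "{s..t}" and f' = "\<lambda>u h. h *\<^sub>R y' u"])
      show "(y has_derivative (\<lambda>h. h *\<^sub>R y' u)) (at u within {s..t})" if "u \<in> {s..t}" for u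
        using y[OF that] by (simp add: has_vector_derivative_def)
      show "onorm (\<lambda>h. h *\<^sub>R y' u) \<le> B" if "u \<in> {s..t}" for u
        using B(2)[OF that] by (intro onorm_le) (simp add: mult.commute[of B] mult_left_mono)
    qed (use uw in auto)
    then show "dist (y u) (y w) \<le> B * dist u w" by (simp add: dist_norm)
  qed (use B in simp)
  then show ?thesis by (rule that)
qed

text \<open>The Dini inequality \<open>D\<^sup>+ v \<le> b v\<close> holds at almost every time: where \<open>v\<close> is positive, divide the
  curve norm derivative formula by \<open>v\<close>; where \<open>v\<close> vanishes, the solution is at the equilibrium with
  zero velocity, so \<open>D\<^sup>+ v \<le> 0\<close>. Forward invariance ensures that the pointwise bound is
  available all along the solution.\<close>

lemma one_sided_bound_imp_exponential_decay:
  fixes f :: "real \<Rightarrow> 'a::euclidean_space \<Rightarrow> 'a"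
  assumes f: "continuous_on ({0..} \<times> UNIV) (\<lambda>(t, x). f t x)"
    and eq: "\<And>t. 0 \<le> t \<Longrightarrow> f t xs = 0"
    and inv: "forward_invariant f C"
    and N: "is_norm N" and curve: "curve_norm_derivative_formula N W"
    and osb: "one_sided_bound f W N C xs b"
  shows "exponential_decay f N C xs b"
  unfolding exponential_decay_def
proof (intro allI impI)
  fix t0 x0 T \<phi> s t
  assume sol: "0 \<le> t0 \<and> x0 \<in> C \<and> is_solution f t0 x0 T \<phi>"
    and st: "t0 \<le> s \<and> s \<le> t \<and> ereal t < T"
  obtain K where K: "0 < K" "\<And>x. N x \<le> K * norm x" and Klip: "K-lipschitz_on UNIV N"
    using is_norm_lipschitz[OF N] by blast
  have below: "ereal u < T" if "u \<le> t" for u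
    using st that by (meson ereal_less_eq(3) order_le_less_trans)
  have der: "(\<phi> has_vector_derivative f u (\<phi> u)) (at u within {s..t})" if u: "u \<in> {s..t}" for u
  proof (rule has_vector_derivative_within_subset)
    show "(\<phi> has_vector_derivative f u (\<phi> u)) (at u within {r. t0 \<le> r \<and> ereal r < T})"
      using sol st u below unfolding is_solution_def by auto
    show "{s..t} \<subseteq> {r. t0 \<le> r \<and> ereal r < T}" using st below by auto
  qed
  have in_C: "\<phi> u \<in> C" if "u \<in> {s..t}" for u
    using inv sol st that below unfolding forward_invariant_def by auto
  have cont: "continuous_on {s..t} \<phi>"
    using der by (meson continuous_on_eq_continuous_within has_vector_derivative_continuous)
  have fcont: "continuous_on {s..t} (\<lambda>u. f u (\<phi> u))"
    by (rule continuous_on_integrand[OF continuous_on_subset[OF f] cont]) (use sol st in auto)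
  define v where "v u = N (\<phi> u - xs)" for u
  define g where "g u = exp (- b * u) * v u" for u
  \<comment> \<open>The weighted distance is the norm of a weighted \<open>C\<^sup>1\<close> curve, hence Lipschitz.\<close>
  define \<psi> where "\<psi> u = exp (- b * u) *\<^sub>R (\<phi> u - xs)" for u
  have g_eq: "g u = N (\<psi> u)" for u
    by (simp add: g_def \<psi>_def v_def seminorm_scaleR[OF is_norm_imp_seminorm[OF N]])
  have \<psi>_der: "(\<psi> has_vector_derivative
      (exp (- b * u) *\<^sub>R f u (\<phi> u) + (- b * exp (- b * u)) *\<^sub>R (\<phi> u - xs))) (at u within {s..t})"
    if "u \<in> {s..t}" for u
    unfolding \<psi>_def using der[OF that]
    by (auto intro!: derivative_eq_intros)
  have "continuous_on {s..t} (\<lambda>u. exp (- b * u) *\<^sub>R f u (\<phi> u) + (- b * exp (- b * u)) *\<^sub>R (\<phi> u - xs))"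
    by (intro continuous_intros fcont cont)
  from lipschitz_on_vector_derivative[OF \<psi>_der this]
  obtain B where "B-lipschitz_on {s..t} \<psi>" by blast
  from lipschitz_on_compose2[OF this lipschitz_on_subset[OF Klip subset_UNIV]]
  have lip: "(K * B)-lipschitz_on {s..t} g" by (simp add: g_eq[abs_def])
  have "g t \<le> g s"
  proof (rule nonincreasing_if_AE_dini_nonpos[OF lip])
    show "s \<le> t" using st by simp
    have der': "((\<lambda>u. \<phi> u - xs) has_vector_derivative f u (\<phi> u)) (at u)" if "u \<in> {s<..<t}" for u
    proof -
      have "(\<phi> has_vector_derivative f u (\<phi> u)) (at u)"
        using der[of u] that at_within_Icc_at[of s u t] by auto
      then show ?thesis by (auto intro!: derivative_eq_intros)
    qed
    then have "AE u in lebesgue. u \<in> {s<..<t} \<longrightarrow>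
        ereal (v u) * upper_right_dini v u = ereal (W (f u (\<phi> u)) (\<phi> u - xs))"
      using curve[unfolded curve_norm_derivative_formula_def, THEN spec[of _ s], THEN spec[of _ t],
          THEN spec[of _ "\<lambda>u. \<phi> u - xs"], THEN spec[of _ "\<lambda>u. f u (\<phi> u)"]]
      unfolding v_def[abs_def] by blast
    then show "AE u in lebesgue. u \<in> {s<..<t} \<longrightarrow>
        (\<forall>e>0. \<forall>\<^sub>F h in at_right 0. g (u + h) \<le> g u + e * h)"
    proof (rule AE_mp, intro AE_I2 impI allI)
      fix u e :: real
      assume formula: "u \<in> {s<..<t} \<longrightarrow>
          ereal (v u) * upper_right_dini v u = ereal (W (f u (\<phi> u)) (\<phi> u - xs))"
        and u: "u \<in> {s<..<t}" and e: "0 < e"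
      have v_dini: "\<forall>\<^sub>F h in at_right 0. v (u + h) \<le> v u + (b * v u + e) * h" if e: "0 < e" for e
      proof (cases "\<phi> u = xs")
        case True
        have "f u (\<phi> u) = 0" using True eq[of u] u sol st by auto
        then have "\<forall>\<^sub>F h in at_right 0. norm (\<phi> (u + h) - xs) \<le> (e / K) * h"
          using right_derivative_remainder[OF der'[OF u], of 1 "e / K"] e K(1) True by simp
        then show ?thesis
        proof eventually_elim
          case (elim h)
          have "v (u + h) \<le> K * norm (\<phi> (u + h) - xs)" unfolding v_def by (rule K(2))
          also have "\<dots> \<le> K * ((e / K) * h)" using elim K(1) by (intro mult_left_mono) auto
          also have "\<dots> = e * h" using K(1) by simp
          finally show ?case
            using True by (simp add: v_def seminorm_zero[OF is_norm_imp_seminorm[OF N]])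
        qed
      next
        case False
        then have pos: "0 < v u" using N unfolding v_def by (auto simp: is_norm_def less_le)
        have "W (f u (\<phi> u)) (\<phi> u - xs) \<le> b * (v u)\<^sup>2"
          using osb in_C[of u] u sol st unfolding one_sided_bound_def v_def by auto
        with formula u have le: "ereal (v u) * upper_right_dini v u \<le> ereal (b * v u * v u)"
          by (simp add: power2_eq_square mult.assoc)
        have "upper_right_dini v u \<le> ereal (b * v u)"
          using le pos by (cases "upper_right_dini v u") (auto simp: mult.commute[of "v u"])
        then show ?thesis using e by (rule upper_right_dini_leD)
      qed
      show "\<forall>\<^sub>F h in at_right 0. g (u + h) \<le> g u + e * h"
        unfolding g_def by (rule dini_exp_weight[OF v_dini e])
    qed
  qed
  then have "exp (b * t) * (exp (- b * t) * v t) \<le> exp (b * t) * (exp (- b * s) * v s)"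
    unfolding g_def by (rule mult_left_mono) simp
  then show "N (\<phi> t - xs) \<le> exp (b * (t - s)) * N (\<phi> s - xs)"
    unfolding v_def by (simp add: mult.assoc[symmetric] exp_add[symmetric] algebra_simps)
qed

theorem theorem33:
  fixes f :: "real \<Rightarrow> real^'n \<Rightarrow> real^'n"
    and xs :: "real^'n"
    and C :: "(real^'n) set"
    and N :: "real^'n \<Rightarrow> real"
    and W :: "real^'n \<Rightarrow> real^'n \<Rightarrow> real"
    and b :: real
  assumes "continuous_on ({0..} \<times> UNIV) (\<lambda>(t, x). f t x)"
    and "\<And>t. 0 \<le> t \<Longrightarrow> f t xs = 0"
    and "open C" and "connected C" and "forward_invariant f C" and "xs \<in> C"
    and "is_norm N" and "weak_pairing W" and "compatible N W"
    and "deimling_inequality N W" and "curve_norm_derivative_formula N W"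
  shows "(one_sided_bound f W N C xs b \<longleftrightarrow> dini_decay f N C xs b) \<and>
         (dini_decay f N C xs b \<longleftrightarrow> exponential_decay f N C xs b) \<and>
         (\<forall>A :: real \<Rightarrow> real^'n \<Rightarrow> real^'n^'n.
            convex C \<and>
            continuous_on ({0..} \<times> C) (\<lambda>(t, x). A t x) \<and>
            (\<forall>t\<ge>0. \<forall>x\<in>C. f t x = A t x *v (x - xs)) \<and>
            (\<forall>t\<ge>0. \<forall>x\<in>C. log_norm N (A t x) \<le> b) \<longrightarrow>
              one_sided_bound f W N C xs b \<and> dini_decay f N C xs b \<and> exponential_decay f N C xs b)"
proof (intro conjI allI impI)
  have osb_exp: "one_sided_bound f W N C xs b \<Longrightarrow> exponential_decay f N C xs b"
    using assms by (intro one_sided_bound_imp_exponential_decay)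
  have exp_dini: "exponential_decay f N C xs b \<Longrightarrow> dini_decay f N C xs b"
    by (rule exponential_decay_imp_dini_decay)
  have dini_osb: "dini_decay f N C xs b \<Longrightarrow> one_sided_bound f W N C xs b"
    using assms by (intro dini_decay_imp_one_sided_bound)
  show "one_sided_bound f W N C xs b \<longleftrightarrow> dini_decay f N C xs b"
    and "dini_decay f N C xs b \<longleftrightarrow> exponential_decay f N C xs b"
    using osb_exp exp_dini dini_osb by blast+
  fix A :: "real \<Rightarrow> real^'n \<Rightarrow> real^'n^'n"
  assume A: "convex C \<and>
      continuous_on ({0..} \<times> C) (\<lambda>(t, x). A t x) \<and>
      (\<forall>t\<ge>0. \<forall>x\<in>C. f t x = A t x *v (x - xs)) \<and>
      (\<forall>t\<ge>0. \<forall>x\<in>C. log_norm N (A t x) \<le> b)"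
  show osb: "one_sided_bound f W N C xs b"
    using A by (intro log_norm_imp_one_sided_bound[OF \<open>is_norm N\<close> \<open>deimling_inequality N W\<close>, of C f A]) auto
  show "exponential_decay f N C xs b" by (rule osb_exp[OF osb])
  then show "dini_decay f N C xs b" by (rule exp_dini)
qed

end
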